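(* Let $G_0=(V,E_0,\mathbf{w}_0)$ be an initial finite weighted graph. Fix any real number $A>1$ satisfying $$A>\max_{e\in E_0}\left(\frac{w_{0,e}}{\min_{e'\in E_0^e}w_{0,e'}}\right),$$ where $E_0^e$ denotes the set of edges of the connected component of $G_0$ containing the edge $e$. Let $(t_k)_{k\in\mathbb{N}}$ be a strictly increasing sequence of positive numbers satisfying $t_k\to+\infty$ as $k\to+\infty$. Then there exists a unique continuous piecewise-linear Ricci curvature flow with $A$-surgeries with respect to the partition $(t_k)_{k\in\mathbb{N}}$ (with initial graph $G_0$). Moreover, there exists a sufficiently large $T>0$ such that: 1. no $A$-surgeries occur for all $t\geq T$; 2. if $\kappa$, the Ricci curvature being used, is $\gamma$-homogeneous for some real number $\gamma$, then for any $t\geq T$ and each connected component $(V',E')$ of the graph $G(t)=(V,E(t),\mathbf{w}(t))$, there exists a constant $\Theta=\Theta(E',\gamma,t)$ satisfying $\kappa_e(t)=\Theta$ for any $e\in E'$.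
   Context: A finite weighted graph $G=(V,E,\mathbf{w})$ has a finite vertex set $V$, a finite edge set $E$ and positive edge weights $\mathbf{w}=(w_e)_{e\in E}$. Ricci curvature: $\kappa$ denotes any Ricci curvature on finite weighted graphs, fixed throughout; it assigns to each edge $e$ of a finite weighted graph $G$ a real number $\kappa_e=\kappa_e(G)$. No specific type is singled out (examples are the Ricci curvatures of Ollivier, Lin-Lu-Yau, Forman, Menger and Haantjes). Homogeneity: $\kappa$ is $\gamma$-homogeneous, for a real number $\gamma$, if for the scaled weighted graphs $G_a=(V,E,a\mathbf{w})$ with $a>0$ one has $\kappa_e(G_a)=a^\gamma\kappa_e(G_1)$ for all $e\in E$. Continuous piecewise-linear Ricci curvature flow with $A$-surgeries: put $t_0=0$, $w_e(0)=w_{0,e}$ and $c_{0,e}=\kappa_e(G_0)$ for $e\in E_0$. Inductively, for $k\geq 1$, given the edge set $E_{k-1}$, the weights $w_e(t_{k-1})$ and the real coefficients $c_{k-1,e}$ for $e\in E_{k-1}$: (a) For $t\in[t_{k-1},t_k]$ and $e\in E_{k-1}$, $w_e$ is the solution of $w_e'(t)=-c_{k-1,e}w_e(t)$ with initial value $w_e(t_{k-1})$ at $t_{k-1}$, that is, $w_e(t)=w_e(t_{k-1})\exp(-c_{k-1,e}(t-t_{k-1}))$. (b) ($A$-surgery at $t_k$) Set $$E_{k-1,A}=\left\{e\in E_{k-1}:\frac{w_e(t_k)}{\min_{e'\in E_{k-1}^e}w_{e'}(t_k)}\geq A\right\},$$ where $E_{k-1}^e$ is the set of edges of the connected component of $(V,E_{k-1})$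 containing $e$. Put $E_k=E_{k-1}\setminus E_{k-1,A}$ and $G_k=(V,E_k,\mathbf{w}(t_k))$, with $\mathbf{w}(t_k)$ giving the weights $w_e(t_k)$, $e\in E_k$. An $A$-surgery occurs at $t_k$ when $E_{k-1,A}\neq\varnothing$, i.e. when edges are actually removed. (c) For $e\in E_k$, set $c_{k,e}=c_{k-1,e}$ if $E_k=E_{k-1}$, and $c_{k,e}=\kappa_e(G_k)$ if $E_k\neq E_{k-1}$. The evolving graph is $G(t)=(V,E(t),\mathbf{w}(t))$, where $E(t)=E_k$ and $\mathbf{w}(t)=(w_e(t))_{e\in E_k}$ for $t\in[t_k,t_{k+1})$, and $\kappa_e(t)$ denotes the Ricci curvature of the edge $e$ in $G(t)$.
   Formalization: Part 2 additionally assumes that the Ricci curvature of an edge depends only on the connected component containing it; for an arbitrary homogeneous assignment of reals to edges part 2 is false, since components may be rescaled by different factors. *)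

theory Defs
  imports Complex_Main "HOL-Library.FuncSet"
begin

text \<open>
  Graphs are undirected and simple, an edge being the set of its two endpoints. Weight functions
  are total in HOL, so they are taken to be \<^const>\<open>undefined\<close> off the edge set (\<^const>\<open>extensional\<close>).
  Thus a value of this type carries no more data than the triple \<open>(V, E, w)\<close>, and a curvature,
  being a function of such a value, cannot look at weights of edges that are not present.
\<close>

record 'v wgraph =
  verts :: "'v set"
  edges :: "'v set set"
  weight :: "'v set \<Rightarrow> real"

definition mk_wgraph :: "'v set \<Rightarrow> 'v set set \<Rightarrow> ('v set \<Rightarrow> real) \<Rightarrow> 'v wgraph" where
  "mk_wgraph V E w = \<lparr>verts = V, edges = E, weight = restrict w E\<rparr>"

definition finite_wgraph :: "'v wgraph \<Rightarrow> bool" where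
  "finite_wgraph G \<longleftrightarrow>
     finite (verts G) \<and> finite (edges G) \<and>
     (\<forall>e\<in>edges G. e \<subseteq> verts G \<and> card e = 2) \<and>
     weight G \<in> extensional (edges G) \<and>
     (\<forall>e\<in>edges G. weight G e > 0)"

definition connected_rel :: "'v set \<Rightarrow> 'v set set \<Rightarrow> ('v \<times> 'v) set" where
  "connected_rel V E = {(u, v). u \<in> V \<and> v \<in> V \<and> (u, v) \<in> {(x, y). {x, y} \<in> E}\<^sup>*}"

definition components :: "'v set \<Rightarrow> 'v set set \<Rightarrow> ('v set \<times> 'v set set) set" where
  "components V E = (\<lambda>V'. (V', {e \<in> E. e \<subseteq> V'})) ` (V // connected_rel V E)"

text \<open>The set \<open>E\<^sup>e\<close> of the edges lying in the same connected component of \<open>(V, E)\<close> as \<open>e\<close>.\<close>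

definition component_edges :: "'v set \<Rightarrow> 'v set set \<Rightarrow> 'v set \<Rightarrow> 'v set set" where
  "component_edges V E e = {f. \<exists>(V', E')\<in>components V E. e \<in> E' \<and> f \<in> E'}"

definition weight_ratio :: "'v set \<Rightarrow> 'v set set \<Rightarrow> ('v set \<Rightarrow> real) \<Rightarrow> 'v set \<Rightarrow> real" where
  "weight_ratio V E w e = w e / Min (w ` component_edges V E e)"


text \<open>Only the values \<open>\<kappa> G e\<close> for a finite weighted graph \<open>G\<close> and an edge \<open>e\<close> of \<open>G\<close> are meaningful.\<close>

type_synonym 'v curvature = "'v wgraph \<Rightarrow> 'v set \<Rightarrow> real"

definition homogeneous :: "real \<Rightarrow> 'v curvature \<Rightarrow> bool" where
  "homogeneous \<gamma> \<kappa> \<longleftrightarrow>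
     (\<forall>G. finite_wgraph G \<longrightarrow>
        (\<forall>a>0. \<forall>e\<in>edges G.
           \<kappa> (mk_wgraph (verts G) (edges G) (\<lambda>f. a * weight G f)) e = a powr \<gamma> * \<kappa> G e))"

text \<open>
  The curvature of an edge is determined by the connected component containing it. The Ricci
  curvatures of Ollivier, Lin-Lu-Yau, Forman, Menger and Haantjes all have this property. For a
  function \<open>\<kappa>\<close> that lacks it, homogeneity says nothing about rescaling the components by different
  factors, which is what the flow eventually does. For example, let \<open>\<kappa>\<close> take the values \<open>0\<close>,
  \<open>ln (w\<^sub>d / w\<^sub>a)\<close>, \<open>1\<close> on the edges \<open>a\<close>, \<open>b\<close>, \<open>d\<close> of the disjoint union of a path with edges \<open>a\<close>, \<open>b\<close>
  and an edge \<open>d\<close>, and vanish on all other graphs. It is 0-homogeneous, and with unit initial weights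
  no surgery ever occurs, but the curvatures of \<open>a\<close> and \<open>b\<close> at time \<open>t\<close> are \<open>0\<close> and \<open>-t\<close>.
\<close>

definition component_local :: "'v curvature \<Rightarrow> bool" where
  "component_local \<kappa> \<longleftrightarrow>
     (\<forall>G. finite_wgraph G \<longrightarrow>
        (\<forall>(V', E')\<in>components (verts G) (edges G). \<forall>e\<in>E'.
           \<kappa> G e = \<kappa> (mk_wgraph V' E' (weight G)) e))"


definition surgery_edges :: "real \<Rightarrow> 'v set \<Rightarrow> 'v set set \<Rightarrow> ('v set \<Rightarrow> real) \<Rightarrow> 'v set set" where
  "surgery_edges A V E w = {e \<in> E. weight_ratio V E w e \<ge> A}"

text \<open>
  The data of a flow are the edge sets \<open>E\<^sub>k\<close>, the weights \<open>w\<^sub>e(s)\<close> (arguments \<open>s\<close>, \<open>e\<close>) and the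
  coefficients \<open>c\<^sub>k\<^sub>,\<^sub>e\<close> (arguments \<open>k\<close>, \<open>e\<close>).
\<close>

record 'v flow =
  flow_edges :: "nat \<Rightarrow> 'v set set"
  flow_weight :: "real \<Rightarrow> 'v set \<Rightarrow> real"
  flow_coeff :: "nat \<Rightarrow> 'v set \<Rightarrow> real"

definition flow_surgery_edges :: "real \<Rightarrow> (nat \<Rightarrow> real) \<Rightarrow> 'v wgraph \<Rightarrow> 'v flow \<Rightarrow> nat \<Rightarrow> 'v set set" where
  "flow_surgery_edges A t G0 F k =
     surgery_edges A (verts G0) (flow_edges F k) (flow_weight F (t (Suc k)))"

text \<open>
  The last two conjuncts make weights and coefficients \<^const>\<open>undefined\<close> outside their domains of
  definition, so that equality of flows is equality of the actual data. The weight of an edge removed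
  at time \<open>t\<^sub>k\<^sub>+\<^sub>1\<close> is still defined at \<open>t\<^sub>k\<^sub>+\<^sub>1\<close>, where it decides the removal.
\<close>

definition surgery_flow ::
    "'v curvature \<Rightarrow> real \<Rightarrow> (nat \<Rightarrow> real) \<Rightarrow> 'v wgraph \<Rightarrow> 'v flow \<Rightarrow> bool" where
  "surgery_flow \<kappa> A t G0 F \<longleftrightarrow>
     flow_edges F 0 = edges G0 \<and>
     (\<forall>e\<in>edges G0. flow_weight F (t 0) e = weight G0 e) \<and>
     (\<forall>e\<in>edges G0. flow_coeff F 0 e = \<kappa> G0 e) \<and>
     (\<forall>k. \<forall>e\<in>flow_edges F k. \<forall>s\<in>{t k..t (Suc k)}.
        ((\<lambda>r. flow_weight F r e) has_real_derivative - flow_coeff F k e * flow_weight F s e)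
          (at s within {t k..t (Suc k)})) \<and>
     (\<forall>k. flow_edges F (Suc k) = flow_edges F k - flow_surgery_edges A t G0 F k) \<and>
     (\<forall>k. \<forall>e\<in>flow_edges F (Suc k).
        flow_coeff F (Suc k) e =
          (if flow_edges F (Suc k) = flow_edges F k then flow_coeff F k e
           else \<kappa> (mk_wgraph (verts G0) (flow_edges F (Suc k)) (flow_weight F (t (Suc k)))) e)) \<and>
     (\<forall>s e. (\<nexists>k. s \<in> {t k..t (Suc k)} \<and> e \<in> flow_edges F k) \<longrightarrow> flow_weight F s e = undefined) \<and>
     (\<forall>k. flow_coeff F k \<in> extensional (flow_edges F k))"

definition evolving_graph :: "(nat \<Rightarrow> real) \<Rightarrow> 'v wgraph \<Rightarrow> 'v flow \<Rightarrow> real \<Rightarrow> 'v wgraph" where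
  "evolving_graph t G0 F s =
     mk_wgraph (verts G0) (flow_edges F (THE k. s \<in> {t k..<t (Suc k)})) (flow_weight F s)"

end

theory Submission
  imports Defs
begin

text \<open>
  The edge sets decrease, hence are constant from some index \<open>K\<close> on. If two edges of a component
  of \<open>(V, E\<^sub>K)\<close> had different coefficients, the ratio of their weights would grow exponentially and
  trigger another surgery. So from \<open>t\<^sub>K\<close> on every component is merely rescaled, and locality and
  homogeneity turn the constancy of the coefficients, which for the least such \<open>K\<close> are the
  curvatures of \<open>G\<^sub>K\<close>, into constancy of the curvature at every later time.
\<close>

section \<open>Uniqueness for the linear decay equation\<close>

lemma exponential_decay_unique:
  fixes f :: "real \<Rightarrow> real"
  assumes "a < b"
    and deriv: "\<And>s. s \<in> {a..b} \<Longrightarrow> (f has_real_derivative - c * f s) (at s within {a..b})"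
    and "s \<in> {a..b}"
  shows "f s = f a * exp (- c * (s - a))"
proof -
  \<comment> \<open>Integrating factor: the product rule cancels the decay, so \<open>g\<close> has
    derivative zero.\<close>
  define g where "g r = f r * exp (c * (r - a))" for r
  have g': "(g has_real_derivative 0) (at r within {a..b})" if "r \<in> {a..b}" for r
    unfolding g_def using deriv[OF that]
    by (auto intro!: derivative_eq_intros simp: algebra_simps)
  have "continuous_on {a..b} g"
    using g' DERIV_continuous by (fastforce simp: continuous_on_eq_continuous_within)
  \<comment> \<open>At the endpoints the derivative is only one-sided; constancy follows from
    two-sided derivatives in the open interval and continuity up to the endpoints.\<close>
  moreover have "(g has_real_derivative 0) (at r)" if "a < r" "r < b" for r
    using g'[of r] that by (simp add: at_within_Icc_at)
  ultimately have const: "g s = g a"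
    using DERIV_isconst2[of a b g s] assms by auto
  have "f s = g s * exp (- c * (s - a))"
    by (simp add: g_def exp_minus_inverse mult.assoc)
  also note const
  finally show ?thesis
    by (simp add: g_def)
qed

section \<open>Components, weight ratios and surgery\<close>

lemma component_edges_subset: "component_edges V E e \<subseteq> E"
  by (auto simp: component_edges_def components_def)

lemma mem_component_edges:
  "\<lbrakk>(V', E') \<in> components V E; e \<in> E'; f \<in> E'\<rbrakk> \<Longrightarrow> f \<in> component_edges V E e"
  by (auto simp: component_edges_def)

lemma surgery_edges_subset: "surgery_edges A V E w \<subseteq> E"
  by (auto simp: surgery_edges_def)

text \<open>The minimum in each ratio ranges over edges of \<open>E\<close> only. This allows
  exchanging weight functions that agree on the current edge set but differ elsewhere.\<close>

lemma surgery_edges_cong: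
  assumes "\<And>e. e \<in> E \<Longrightarrow> w e = w' e"
  shows "surgery_edges A V E w = surgery_edges A V E w'"
proof -
  have "w ` component_edges V E e = w' ` component_edges V E e" for e
    using component_edges_subset[of V E e] assms by (intro image_cong) auto
  then show ?thesis
    using assms by (auto simp: surgery_edges_def weight_ratio_def)
qed

lemma weight_ratio_ge:
  assumes "finite E" and pos: "\<And>e. e \<in> E \<Longrightarrow> w e > 0"
    and "e \<in> E" "f \<in> component_edges V E e"
  shows "w e / w f \<le> weight_ratio V E w e"
proof -
  let ?C = "component_edges V E e"
  have fin: "finite (w ` ?C)"
    using finite_subset[OF component_edges_subset assms(1)] by simp
  \<comment> \<open>The minimum is attained at an edge, hence positive; without this the division
    could not be compared.\<close>
  have "Min (w ` ?C) \<in> w ` ?C"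
    using fin assms(4) by (intro Min_in) auto
  then have "Min (w ` ?C) > 0"
    using component_edges_subset[of V E e] pos by auto
  moreover have "Min (w ` ?C) \<le> w f"
    using fin assms(4) by (intro Min_le) auto
  ultimately show ?thesis
    unfolding weight_ratio_def using pos[OF assms(3)] by (intro divide_left_mono) auto
qed

section \<open>Weighted graphs and the curvature of a rescaled component\<close>

lemma mk_wgraph_cong:
  "(\<And>e. e \<in> E \<Longrightarrow> w e = w' e) \<Longrightarrow> mk_wgraph V E w = mk_wgraph V E w'"
  unfolding mk_wgraph_def by (metis restrict_ext)

lemma mk_wgraph_self: "finite_wgraph G \<Longrightarrow> mk_wgraph (verts G) (edges G) (weight G) = G"
  by (cases G) (auto simp: mk_wgraph_def finite_wgraph_def extensional_restrict)

lemma finite_wgraph_mk_wgraph: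
  assumes "finite V" "finite E" "\<And>e. e \<in> E \<Longrightarrow> e \<subseteq> V \<and> card e = 2" "\<And>e. e \<in> E \<Longrightarrow> w e > 0"
  shows "finite_wgraph (mk_wgraph V E w)"
  using assms by (auto simp: finite_wgraph_def mk_wgraph_def)

lemma components_subset:
  assumes "(V', E') \<in> components V E"
  shows "V' \<subseteq> V" "E' = {e \<in> E. e \<subseteq> V'}"
  using assms by (auto simp: components_def quotient_def connected_rel_def)

text \<open>Homogeneity speaks of scaling a whole graph, whereas \<open>w'\<close> is a multiple of
  \<open>w\<close> on one component only. Locality passes to that component as a graph of its own,
  homogeneity applies there, and locality leads back.\<close>

lemma component_curvature_rescale:
  assumes "component_local \<kappa>" "homogeneous \<gamma> \<kappa>"
    and "finite V" "finite E" "\<And>e. e \<in> E \<Longrightarrow> e \<subseteq> V \<and> card e = 2"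
    and "\<And>e. e \<in> E \<Longrightarrow> w e > 0" "\<And>e. e \<in> E \<Longrightarrow> w' e > 0"
    and comp: "(V', E') \<in> components V E"
    and "a > 0" and scale: "\<And>f. f \<in> E' \<Longrightarrow> w' f = a * w f"
    and "e \<in> E'"
  shows "\<kappa> (mk_wgraph V E w') e = a powr \<gamma> * \<kappa> (mk_wgraph V E w) e"
proof -
  let ?H = "mk_wgraph V' E' w"
  note sub = components_subset[OF comp]
  \<comment> \<open>The weights \<open>u\<close> are arbitrary since this is used for both
    \<open>w\<close> and \<open>w'\<close>.\<close>
  have restr: "\<kappa> (mk_wgraph V E u) e = \<kappa> (mk_wgraph V' E' u) e"
    if "\<And>e. e \<in> E \<Longrightarrow> u e > 0" for u
  proof -
    have "finite_wgraph (mk_wgraph V E u)"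
      using assms that by (intro finite_wgraph_mk_wgraph) auto
    moreover have "(V', E') \<in> components (verts (mk_wgraph V E u)) (edges (mk_wgraph V E u))"
      using comp by (simp add: mk_wgraph_def)
    ultimately have "\<kappa> (mk_wgraph V E u) e = \<kappa> (mk_wgraph V' E' (weight (mk_wgraph V E u))) e"
      using assms(1) \<open>e \<in> E'\<close> unfolding component_local_def by fast
    also have "mk_wgraph V' E' (weight (mk_wgraph V E u)) = mk_wgraph V' E' u"
      using sub(2) by (intro mk_wgraph_cong) (auto simp: mk_wgraph_def)
    finally show ?thesis .
  qed
  have "finite_wgraph ?H"
    using assms(3-6) sub by (intro finite_wgraph_mk_wgraph) (auto intro: finite_subset)
  then have "\<kappa> (mk_wgraph (verts ?H) (edges ?H) (\<lambda>f. a * weight ?H f)) e = a powr \<gamma> * \<kappa> ?H e"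
    using assms(2)[unfolded homogeneous_def, rule_format, of ?H a e] \<open>a > 0\<close> \<open>e \<in> E'\<close>
    by (simp add: mk_wgraph_def)
  moreover have "mk_wgraph (verts ?H) (edges ?H) (\<lambda>f. a * weight ?H f) = mk_wgraph V' E' w'"
    by (simp add: mk_wgraph_def restrict_def fun_eq_iff scale)
  ultimately show ?thesis
    using restr assms(6,7) by metis
qed

lemma antimono_finite_set_stabilizes:
  fixes E :: "nat \<Rightarrow> 'a set"
  assumes "finite (E 0)" and "\<And>k. E (Suc k) \<subseteq> E k"
  shows "\<exists>K. \<forall>k\<ge>K. E k = E K"
proof -
  have anti: "E k \<subseteq> E j" if "j \<le> k" for j k
    using lift_Suc_antimono_le[of E] assms(2) that by blast
  have fin: "finite (E k)" for k
    using anti[of 0 k] assms(1) finite_subset by auto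
  \<comment> \<open>An index of least cardinality: a later set is contained in \<open>E K\<close>
    and has at least as many elements, so it equals \<open>E K\<close>.\<close>
  obtain K where K: "\<And>k. card (E K) \<le> card (E k)"
    using ex_has_least_nat[of "\<lambda>_. True" 0 "\<lambda>k. card (E k)"] by auto
  have "E k = E K" if "k \<ge> K" for k
    using anti[OF that] fin K by (simp add: card_seteq)
  then show ?thesis by blast
qed

section \<open>The partition of the time axis\<close>

locale flow_data =
  fixes \<kappa> :: "'v curvature" and A :: real and t :: "nat \<Rightarrow> real" and G0 :: "'v wgraph"
  assumes G0: "finite_wgraph G0"
    and t0: "t 0 = 0"
    and t_mono: "strict_mono t"
    and t_lim: "filterlim t at_top sequentially"
begin

lemma t_less: "t k < t (Suc k)"
  using t_mono by (simp add: strict_mono_Suc_iff)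

lemma t_le_iff: "t j \<le> t k \<longleftrightarrow> j \<le> k"
  using t_mono by (simp add: strict_mono_less_eq)

lemma in_two_intervals:
  assumes "s \<in> {t j..t (Suc j)}" "s \<in> {t k..t (Suc k)}" "j < k"
  shows "k = Suc j" "s = t (Suc j)"
proof -
  have "t k \<le> t (Suc j)" using assms by auto
  then show "k = Suc j" using assms(3) t_le_iff[of k "Suc j"] by simp
  then show "s = t (Suc j)" using assms by simp
qed

lemma ex_interval:
  assumes "s \<ge> 0"
  obtains k where "s \<in> {t k..<t (Suc k)}"
proof -
  obtain n where n: "s < t n"
    using filterlim_at_top_dense[THEN iffD1, OF t_lim, rule_format, of s]
    by (auto simp: eventually_sequentially)
  \<comment> \<open>The first breakpoint beyond \<open>s\<close>. It is not \<open>t 0\<close>, as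
    \<open>t 0 = 0\<close> and \<open>s\<close> is nonnegative, so its predecessor starts the
    interval sought.\<close>
  define m where "m = (LEAST n. s < t n)"
  have m: "s < t m" unfolding m_def using n by (rule LeastI)
  then obtain k where "m = Suc k" using assms t0 by (cases m) auto
  moreover from this have "\<not> s < t k"
    using not_less_Least[of k "\<lambda>n. s < t n"] by (simp add: m_def)
  ultimately show ?thesis using that[of k] m by simp
qed

lemma the_interval:
  assumes "s \<in> {t k..<t (Suc k)}"
  shows "(THE k. s \<in> {t k..<t (Suc k)}) = k"
proof (rule the_equality)
  fix j assume "s \<in> {t j..<t (Suc j)}"
  then show "j = k"
    using assms in_two_intervals(2)[of s j k] in_two_intervals(2)[of s k j]
    by (cases j k rule: linorder_cases) auto
qed (fact assms)

section \<open>Existence: recursion over the breakpoints and gluing of the pieces\<close>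

primrec state :: "nat \<Rightarrow> 'v set set \<times> ('v set \<Rightarrow> real) \<times> ('v set \<Rightarrow> real)" where
  "state 0 = (edges G0, weight G0, restrict (\<kappa> G0) (edges G0))"
| "state (Suc k) =
    (case state k of (E, w, c) \<Rightarrow>
      let w' = (\<lambda>e. w e * exp (- c e * (t (Suc k) - t k)));
          E' = E - surgery_edges A (verts G0) E w'
      in (E', w', restrict (if E' = E then c else \<kappa> (mk_wgraph (verts G0) E' w')) E'))"

definition state_edges where "state_edges k = fst (state k)"
definition state_weight where "state_weight k = fst (snd (state k))"
definition state_coeff where "state_coeff k = snd (snd (state k))"

definition piece :: "nat \<Rightarrow> real \<Rightarrow> 'v set \<Rightarrow> real" where
  "piece k s e = state_weight k e * exp (- state_coeff k e * (s - t k))"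

lemma state_0:
  "state_edges 0 = edges G0" "state_weight 0 = weight G0"
  "state_coeff 0 = restrict (\<kappa> G0) (edges G0)"
  by (simp_all add: state_edges_def state_weight_def state_coeff_def)

lemma state_Suc:
  "state_edges (Suc k) =
    state_edges k - surgery_edges A (verts G0) (state_edges k) (piece k (t (Suc k)))"
  "state_weight (Suc k) = piece k (t (Suc k))"
  "state_coeff (Suc k) = restrict
    (if state_edges (Suc k) = state_edges k then state_coeff k
     else \<kappa> (mk_wgraph (verts G0) (state_edges (Suc k)) (state_weight (Suc k))))
    (state_edges (Suc k))"
  by (auto simp: state_edges_def state_weight_def state_coeff_def piece_def[abs_def] Let_def
      split: prod.splits)

lemma piece_start: "piece k (t k) = state_weight k"
  by (simp add: piece_def fun_eq_iff)

text \<open>Distinct closed intervals meet at most in a common breakpoint, where the later piece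
  starts from the value of the earlier one. The equality holds for all arguments, because
  \<open>state\<close> never restricts its weights to the surviving edges.\<close>

lemma piece_eq:
  assumes "s \<in> {t j..t (Suc j)}" "s \<in> {t k..t (Suc k)}"
  shows "piece j s = piece k s"
proof -
  have "piece j s = piece k s"
    if "j < k" "s \<in> {t j..t (Suc j)}" "s \<in> {t k..t (Suc k)}" for j k
    using in_two_intervals[OF that(2,3,1)] by (simp add: piece_start state_Suc)
  then show ?thesis
    using assms by (cases j k rule: linorder_cases) auto
qed

text \<open>At a breakpoint two indices may qualify; \<open>piece_eq\<close> makes the choice
  harmless. Closed intervals keep the weight of a removed edge defined at the moment of its
  removal.\<close>

definition canonical_weight :: "real \<Rightarrow> 'v set \<Rightarrow> real" where
  "canonical_weight s e =
    (if \<exists>k. s \<in> {t k..t (Suc k)} \<and> e \<in> state_edges k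
     then piece (SOME k. s \<in> {t k..t (Suc k)} \<and> e \<in> state_edges k) s e else undefined)"

lemma canonical_weight:
  assumes "s \<in> {t k..t (Suc k)}" "e \<in> state_edges k"
  shows "canonical_weight s e = piece k s e"
proof -
  let ?P = "\<lambda>k. s \<in> {t k..t (Suc k)} \<and> e \<in> state_edges k"
  have "?P k" using assms by simp
  then have "?P (SOME k. ?P k)" by (rule someI)
  then have "piece (SOME k. ?P k) s = piece k s"
    using assms(1) piece_eq by blast
  then show ?thesis
    using assms unfolding canonical_weight_def by auto
qed

definition canonical_flow :: "'v flow" where
  "canonical_flow =
    \<lparr>flow_edges = state_edges, flow_weight = canonical_weight, flow_coeff = state_coeff\<rparr>"

lemma surgery_flow_canonical: "surgery_flow \<kappa> A t G0 canonical_flow"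
proof -
  have left: "t k \<in> {t k..t (Suc k)}" and right: "t (Suc k) \<in> {t k..t (Suc k)}" for k
    using t_less[of k] by auto
  have init: "canonical_weight (t 0) e = weight G0 e" if "e \<in> edges G0" for e
    using canonical_weight[OF left, of e 0] that by (simp add: piece_start state_0)
  have ode: "((\<lambda>r. canonical_weight r e) has_real_derivative
      - state_coeff k e * canonical_weight s e) (at s within {t k..t (Suc k)})"
    if e: "e \<in> state_edges k" and s: "s \<in> {t k..t (Suc k)}" for k e s
  proof -
    have "((\<lambda>r. piece k r e) has_real_derivative - state_coeff k e * piece k s e)
        (at s within {t k..t (Suc k)})"
      unfolding piece_def by (auto intro!: derivative_eq_intros)
    \<comment> \<open>A derivative within the closed interval sees only values there, where the
      glued weight is \<open>piece k\<close>.\<close>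
    then show ?thesis
      using e s canonical_weight[OF _ e]
      by (subst has_field_derivative_cong_eventually[where g = "\<lambda>r. piece k r e"])
         (auto simp: eventually_at_filter)
  qed
  \<comment> \<open>At \<open>t (Suc k)\<close> the surgery test reads the weights from the interval
    that ends there, since removed edges exist only on that side; the new graph in
    \<open>graph\<close> reads them from the interval that begins there.\<close>
  have surg: "surgery_edges A (verts G0) (state_edges k) (canonical_weight (t (Suc k))) =
      surgery_edges A (verts G0) (state_edges k) (piece k (t (Suc k)))" for k
    by (intro surgery_edges_cong canonical_weight right)
  have graph: "mk_wgraph (verts G0) (state_edges (Suc k)) (canonical_weight (t (Suc k))) =
      mk_wgraph (verts G0) (state_edges (Suc k)) (state_weight (Suc k))" for k
    by (intro mk_wgraph_cong) (simp add: canonical_weight[OF left] piece_start)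
  have ext: "state_coeff k \<in> extensional (state_edges k)" for k
    by (cases k) (simp_all add: state_0 state_Suc(3))
  have edges: "state_edges (Suc k) = state_edges k -
      surgery_edges A (verts G0) (state_edges k) (canonical_weight (t (Suc k)))" for k
    by (simp add: surg state_Suc(1))
  have coeff: "state_coeff (Suc k) e =
      (if state_edges (Suc k) = state_edges k then state_coeff k e
       else \<kappa> (mk_wgraph (verts G0) (state_edges (Suc k)) (canonical_weight (t (Suc k)))) e)"
    if "e \<in> state_edges (Suc k)" for k e
    unfolding graph using that by (subst state_Suc(3)) simp
  have undef: "canonical_weight s e = undefined"
    if "\<nexists>k. s \<in> {t k..t (Suc k)} \<and> e \<in> state_edges k" for s e
    using that by (simp only: canonical_weight_def if_False)
  show ?thesis
    unfolding surgery_flow_def canonical_flow_def flow_surgery_edges_def flow.select_convs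
    by (intro conjI allI ballI impI init ode edges coeff undef ext)
       (simp_all add: state_0)
qed

end

section \<open>Uniqueness: an arbitrary flow agrees with the constructed one\<close>

locale surgery_flow_solution = flow_data +
  fixes F :: "'a flow"
  assumes flow: "surgery_flow \<kappa> A t G0 F"
begin

abbreviation E where "E \<equiv> flow_edges F"
abbreviation w where "w \<equiv> flow_weight F"
abbreviation c where "c \<equiv> flow_coeff F"

lemma flow_0: "E 0 = edges G0" "e \<in> edges G0 \<Longrightarrow> w (t 0) e = weight G0 e"
    "e \<in> edges G0 \<Longrightarrow> c 0 e = \<kappa> G0 e"
  using flow unfolding surgery_flow_def by auto

lemma E_Suc: "E (Suc k) = E k - surgery_edges A (verts G0) (E k) (w (t (Suc k)))"
  using flow unfolding surgery_flow_def flow_surgery_edges_def by auto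

lemma c_Suc: "e \<in> E (Suc k) \<Longrightarrow> c (Suc k) e =
    (if E (Suc k) = E k then c k e else \<kappa> (mk_wgraph (verts G0) (E (Suc k)) (w (t (Suc k)))) e)"
  using flow unfolding surgery_flow_def by blast

lemma c_extensional: "c k \<in> extensional (E k)"
  using flow unfolding surgery_flow_def by blast

lemma w_undefined: "(\<nexists>k. s \<in> {t k..t (Suc k)} \<and> e \<in> E k) \<Longrightarrow> w s e = undefined"
  using flow unfolding surgery_flow_def by blast

lemma w_eq:
  assumes "e \<in> E k" "s \<in> {t k..t (Suc k)}"
  shows "w s e = w (t k) e * exp (- c k e * (s - t k))"
proof (rule exponential_decay_unique[OF t_less _ assms(2)])
  show "((\<lambda>r. w r e) has_real_derivative - c k e * w r e) (at r within {t k..t (Suc k)})"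
    if "r \<in> {t k..t (Suc k)}" for r
    using flow assms(1) that unfolding surgery_flow_def by blast
qed

text \<open>Solving the equation on one interval determines the next weights, these determine the
  surgery, and the surgery determines the coefficients. Extensionality gives equality of
  coefficients as functions; weights are compared on current edges only.\<close>

lemma flow_eq_state:
  "E k = state_edges k \<and> c k = state_coeff k \<and> (\<forall>e\<in>E k. w (t k) e = state_weight k e)"
proof (induction k)
  case 0
  have "c 0 = restrict (\<kappa> G0) (edges G0)"
    using c_extensional[of 0] flow_0 by (intro extensionalityI[of _ "edges G0"]) auto
  then show ?case
    using flow_0 by (simp add: state_0)
next
  case (Suc k)
  \<comment> \<open>Needed on all of \<open>E k\<close>, not just on the survivors, because the
    edges to be removed take part in the surgery test.\<close>
  have w: "w (t (Suc k)) e = piece k (t (Suc k)) e" if "e \<in> E k" for e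
    using w_eq[OF that, of "t (Suc k)"] t_less[of k] Suc that by (simp add: piece_def)
  have E: "E (Suc k) = state_edges (Suc k)"
    using E_Suc[of k] surgery_edges_cong[of "E k", OF w] Suc by (simp add: state_Suc)
  have w': "w (t (Suc k)) e = state_weight (Suc k) e" if "e \<in> E (Suc k)" for e
    using w that E_Suc by (auto simp: state_Suc(2))
  have "c (Suc k) = state_coeff (Suc k)"
  proof (rule extensionalityI[of _ "E (Suc k)"])
    show "c (Suc k) e = state_coeff (Suc k) e" if "e \<in> E (Suc k)" for e
      using c_Suc[OF that] mk_wgraph_cong[of "E (Suc k)", OF w'] Suc E that
      by (simp add: state_Suc(3))
  qed (use c_extensional[of "Suc k"] E in \<open>simp_all add: state_Suc(3)\<close>)
  then show ?case using E w' by simp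
qed

lemma flow_eq_canonical: "F = canonical_flow"
proof -
  have "w s e = canonical_weight s e" for s e
  proof (cases "\<exists>k. s \<in> {t k..t (Suc k)} \<and> e \<in> E k")
    case True
    then obtain k where k: "s \<in> {t k..t (Suc k)}" "e \<in> E k" by blast
    then show ?thesis
      using w_eq[OF k(2,1)] canonical_weight[OF k(1)] flow_eq_state[of k]
      by (simp add: piece_def)
  next
    case False
    then have "\<nexists>k. s \<in> {t k..t (Suc k)} \<and> e \<in> state_edges k"
      using flow_eq_state by blast
    then show ?thesis
      using w_undefined[OF False] by (simp only: canonical_weight_def if_False)
  qed
  then have "w = canonical_weight" by blast
  moreover have "E = state_edges" "c = state_coeff"
    using flow_eq_state by blast+
  ultimately show ?thesis
    by (cases F) (simp add: canonical_flow_def)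
qed

section \<open>Decreasing edge sets and positive weights\<close>

lemma E_antimono: "j \<le> k \<Longrightarrow> E k \<subseteq> E j"
  using lift_Suc_antimono_le[of E j k] E_Suc by blast

lemma E_subset: "E k \<subseteq> edges G0"
  using E_antimono[of 0 k] flow_0 by simp

lemma finite_E: "finite (E k)"
  using finite_subset[OF E_subset] G0 by (simp add: finite_wgraph_def)

lemma w_pos: "e \<in> E k \<Longrightarrow> w (t k) e > 0"
proof (induction k)
  case 0
  then show ?case using G0 flow_0 by (simp add: finite_wgraph_def)
next
  case (Suc k)
  then have "e \<in> E k" using E_Suc by blast
  then show ?case
    using w_eq[of e k "t (Suc k)"] t_less[of k] Suc.IH by simp
qed

section \<open>Behaviour once the edge set has become constant\<close>

context
  fixes K
  assumes stable: "\<And>k. k \<ge> K \<Longrightarrow> E k = E K"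
begin

lemma c_stable:
  assumes "e \<in> E K" "k \<ge> K"
  shows "c k e = c K e"
  using assms(2)
proof (induction k rule: dec_induct)
  case (step k)
  have "E k = E K" "E (Suc k) = E K"
    using stable[of k] stable[of "Suc k"] step.hyps by auto
  then show ?case using assms(1) c_Suc[of e k] step.IH by simp
qed simp

text \<open>The coefficient no longer changes, so the exponents of successive intervals add up to a
  single exponential from \<open>t K\<close> on.\<close>

lemma w_stable:
  assumes "e \<in> E K" "k \<ge> K" "s \<in> {t k..t (Suc k)}"
  shows "w s e = w (t K) e * exp (- c K e * (s - t K))"
proof -
  have on_interval: "w r e = w (t j) e * exp (- c K e * (r - t j))"
    if "j \<ge> K" "r \<in> {t j..t (Suc j)}" for j r
    using w_eq[of e j r] that assms(1) stable[of j] c_stable[of e j] by simp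
  have "w (t k) e = w (t K) e * exp (- c K e * (t k - t K))"
    using assms(2)
  proof (induction k rule: dec_induct)
    case (step j)
    have "w (t (Suc j)) e = w (t j) e * exp (- c K e * (t (Suc j) - t j))"
      using on_interval[of j "t (Suc j)"] step.hyps t_less[of j]
      by simp
    then show ?case
      using step.IH by (simp add: algebra_simps flip: exp_add)
  qed simp
  then show ?thesis
    using on_interval[OF assms(2,3)] by (simp add: algebra_simps flip: exp_add)
qed

lemma no_surgery: "k \<ge> K \<Longrightarrow> surgery_edges A (verts G0) (E k) (w (t (Suc k))) = {}"
  using E_Suc[of k] stable[of k] stable[of "Suc k"] surgery_edges_subset by fastforce

text \<open>An edge that survives the test has ratio below \<open>A\<close> even against the
  lightest edge of its component. The test, and so the bound, is available only at
  breakpoints.\<close>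

lemma ratio_less:
  assumes "(V', E') \<in> components (verts G0) (E K)" "e \<in> E'" "f \<in> E'" "k \<ge> K"
  shows "w (t (Suc k)) e / w (t (Suc k)) f < A"
proof -
  have Ek: "E k = E K" "E (Suc k) = E K"
    using stable[of k] stable[of "Suc k"] assms(4) by auto
  have e: "e \<in> E k"
    using components_subset(2)[OF assms(1)] assms(2) Ek by auto
  have "w (t (Suc k)) e / w (t (Suc k)) f \<le> weight_ratio (verts G0) (E k) (w (t (Suc k))) e"
    using finite_E w_pos[of _ "Suc k"] e mem_component_edges[OF assms(1-3)] Ek
    by (intro weight_ratio_ge) auto
  also have "\<dots> < A"
    using no_surgery[OF assms(4)] e by (auto simp: surgery_edges_def)
  finally show ?thesis .
qed

text \<open>A larger coefficient on \<open>f\<close> would make the ratio of \<open>w e\<close> to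
  \<open>w f\<close> unbounded. Exchanging \<open>e\<close> and \<open>f\<close> then yields
  equality of the coefficients.\<close>

lemma coeff_le_on_component:
  assumes "(V', E') \<in> components (verts G0) (E K)" "e \<in> E'" "f \<in> E'"
  shows "c K f \<le> c K e"
proof (rule ccontr)
  assume "\<not> c K f \<le> c K e"
  then have d: "c K f - c K e > 0" by simp
  have eK: "e \<in> E K" "f \<in> E K"
    using components_subset(2)[OF assms(1)] assms by auto
  define q where "q = w (t K) e / w (t K) f"
  have q: "q > 0" using w_pos eK by (simp add: q_def)
  \<comment> \<open>Replacing the exponential by its tangent at zero leaves a linear bound, which
    fails once the elapsed time exceeds \<open>A / (q * (c K f - c K e))\<close>.\<close>
  have bound: "q * (1 + (c K f - c K e) * (t (Suc k) - t K)) < A" if "k \<ge> K" for k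
  proof -
    have s: "t (Suc k) \<in> {t k..t (Suc k)}" using t_less[of k] by simp
    have "w (t (Suc k)) e / w (t (Suc k)) f = q * exp ((c K f - c K e) * (t (Suc k) - t K))"
      unfolding w_stable[OF eK(1) that s] w_stable[OF eK(2) that s] q_def
      by (simp add: exp_diff exp_minus field_simps flip: exp_add)
    moreover have "1 + (c K f - c K e) * (t (Suc k) - t K)
        \<le> exp ((c K f - c K e) * (t (Suc k) - t K))"
      by (rule exp_ge_add_one_self)
    ultimately show ?thesis
      using ratio_less[OF assms that] q by (smt (verit) mult_left_mono)
  qed
  have "\<forall>\<^sub>F k in sequentially. t K + A / (q * (c K f - c K e)) < t k"
    using t_lim by (simp add: filterlim_at_top_dense)
  then obtain N where N: "\<And>k. k \<ge> N \<Longrightarrow> t K + A / (q * (c K f - c K e)) < t k"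
    by (auto simp: eventually_sequentially)
  \<comment> \<open>The index \<open>max K N\<close> is both in the stable range and past the
    critical time; the bound concerns the breakpoint after it.\<close>
  have "A / (q * (c K f - c K e)) < t (Suc (max K N)) - t K"
    using N[OF le_SucI[OF max.cobounded2], of K] by simp
  then have "A < q * ((c K f - c K e) * (t (Suc (max K N)) - t K))"
    using d q by (simp add: pos_divide_less_eq mult_ac)
  then show False
    using bound[of "max K N"] q by (simp add: distrib_left)
qed

text \<open>Equal coefficients multiply all weights of the component by one factor \<open>a\<close>,
  so \<Theta> is \<open>a powr \<gamma>\<close> times the common coefficient, which by
  \<open>curv\<close> is the curvature at time \<open>t K\<close>.\<close>

lemma curvature_constant:
  assumes "component_local \<kappa>" "homogeneous \<gamma> \<kappa>"
    and curv: "\<And>e. e \<in> E K \<Longrightarrow> c K e = \<kappa> (mk_wgraph (verts G0) (E K) (w (t K))) e"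
    and comp: "(V', E') \<in> components (verts G0) (E K)"
    and "k \<ge> K" "s \<in> {t k..t (Suc k)}"
  shows "\<exists>\<Theta>. \<forall>e\<in>E'. \<kappa> (mk_wgraph (verts G0) (E K) (w s)) e = \<Theta>"
\<comment> \<open>An isolated vertex is a component without edges and offers no \<open>e0\<close>;
  any \<Theta> serves there.\<close>
proof (cases "E' = {}")
  case False
  then obtain e0 where e0: "e0 \<in> E'" by blast
  define a where "a = exp (- c K e0 * (s - t K))"
  have sub: "E' \<subseteq> E K" using components_subset(2)[OF comp] by auto
  have c: "c K e = c K e0" if "e \<in> E'" for e
    using coeff_le_on_component[OF comp] that e0 by (metis order_antisym)
  have scale: "w s e = a * w (t K) e" if "e \<in> E'" for e
    using w_stable[OF _ assms(5,6)] that sub c[OF that] by (auto simp: a_def)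
  have "\<kappa> (mk_wgraph (verts G0) (E K) (w s)) e =
      a powr \<gamma> * \<kappa> (mk_wgraph (verts G0) (E K) (w (t K))) e" if "e \<in> E'" for e
  proof (rule component_curvature_rescale[OF assms(1,2) _ _ _ _ _ comp _ scale that])
    show "0 < w s f" if "f \<in> E K" for f
      using w_stable[OF that assms(5,6)] w_pos[OF that] by simp
    show "f \<subseteq> verts G0 \<and> card f = 2" if "f \<in> E K" for f
      using G0 E_subset that unfolding finite_wgraph_def by blast
    show "finite (verts G0)" using G0 by (simp add: finite_wgraph_def)
  qed (auto simp: a_def finite_E w_pos)
  then have "\<forall>e\<in>E'. \<kappa> (mk_wgraph (verts G0) (E K) (w s)) e = a powr \<gamma> * c K e0"
    using curv c sub by (metis subsetD)
  then show ?thesis by blast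
qed simp

end

text \<open>The least stable index is chosen so that the coefficients are fresh: it is 0, where they
  are the initial curvatures, or edges were removed exactly there and the curvatures were
  recomputed.\<close>

lemma eventually_stable:
  "\<exists>K. (\<forall>k\<ge>K. E k = E K) \<and>
    (\<forall>e\<in>E K. c K e = \<kappa> (mk_wgraph (verts G0) (E K) (w (t K))) e)"
proof -
  let ?P = "\<lambda>K. \<forall>k\<ge>K. E k = E K"
  define K where "K = (LEAST K. ?P K)"
  have "\<exists>K. ?P K"
    using antimono_finite_set_stabilizes[of E] finite_E E_Suc by blast
  then have K: "?P K" unfolding K_def by (rule LeastI_ex)
  have "c K e = \<kappa> (mk_wgraph (verts G0) (E K) (w (t K))) e" if e: "e \<in> E K" for e
  proof (cases K)
    case 0
    have "mk_wgraph (verts G0) (E 0) (w (t 0)) = mk_wgraph (verts G0) (edges G0) (weight G0)"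
      unfolding flow_0(1) by (intro mk_wgraph_cong flow_0(2))
    then show ?thesis
      using 0 e flow_0 mk_wgraph_self[OF G0] by simp
  next
    case (Suc j)
    \<comment> \<open>Had nothing been removed at \<open>t (Suc j)\<close>, then \<open>j\<close>
      would already be stable, against minimality.\<close>
    have "\<not> ?P j" using not_less_Least[of j ?P] Suc by (simp add: K_def)
    moreover have "?P j" if "E (Suc j) = E j"
      using that K Suc by (metis le_antisym not_less_eq_eq)
    ultimately have "E (Suc j) \<noteq> E j" by blast
    then show ?thesis using c_Suc[of e j] e Suc by simp
  qed
  then show ?thesis using K by blast
qed

lemma eventually_constant_curvature:
  "\<exists>T>0. (\<forall>k. t (Suc k) \<ge> T \<longrightarrow> flow_surgery_edges A t G0 F k = {}) \<and>
    (component_local \<kappa> \<longrightarrow> (\<forall>\<gamma>. homogeneous \<gamma> \<kappa> \<longrightarrow>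
      (\<forall>s\<ge>T. \<forall>(V', E')\<in>components (verts (evolving_graph t G0 F s)) (edges (evolving_graph t G0 F s)).
        \<exists>\<Theta>. \<forall>e\<in>E'. \<kappa> (evolving_graph t G0 F s) e = \<Theta>)))"
proof -
  obtain K where stable: "\<forall>k\<ge>K. E k = E K"
    and coeff: "\<forall>e\<in>E K. c K e = \<kappa> (mk_wgraph (verts G0) (E K) (w (t K))) e"
    using eventually_stable by blast
  note K = stable[rule_format] and curv = coeff[rule_format]
  have tK: "t K \<ge> 0" using t_le_iff[of 0 K] t0 by simp
  \<comment> \<open>The summand 1 makes the threshold positive even if \<open>K\<close> is 0, and
    excludes a surgery at \<open>t K\<close> itself: \<open>t (Suc k) > t K\<close> forces
    \<open>k \<ge> K\<close>.\<close>
  have late: "k \<ge> K" if "t (Suc k) \<ge> t K + 1" for k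
    using that t_le_iff[of "Suc k" K] by linarith
  have graph: "\<exists>k\<ge>K. s \<in> {t k..t (Suc k)} \<and>
      evolving_graph t G0 F s = mk_wgraph (verts G0) (E K) (w s)" if s: "s \<ge> t K + 1" for s
  proof -
    obtain k where k: "s \<in> {t k..<t (Suc k)}"
      using ex_interval[of s] s tK by auto
    then have "k \<ge> K" using late[of k] s by auto
    then show ?thesis
      using k K[of k] the_interval[OF k] by (auto simp: evolving_graph_def)
  qed
  show ?thesis
  proof (intro exI[of _ "t K + 1"] conjI allI impI)
    show "flow_surgery_edges A t G0 F k = {}" if "t (Suc k) \<ge> t K + 1" for k
      using no_surgery[OF K late[OF that]] by (simp add: flow_surgery_edges_def)
    fix \<gamma> s assume hom: "component_local \<kappa>" "homogeneous \<gamma> \<kappa>" and s: "s \<ge> t K + 1"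
    obtain k where "k \<ge> K" "s \<in> {t k..t (Suc k)}"
      and G: "evolving_graph t G0 F s = mk_wgraph (verts G0) (E K) (w s)"
      using graph[OF s] by blast
    then show "\<forall>(V', E')\<in>components (verts (evolving_graph t G0 F s)) (edges (evolving_graph t G0 F s)).
        \<exists>\<Theta>. \<forall>e\<in>E'. \<kappa> (evolving_graph t G0 F s) e = \<Theta>"
      using curvature_constant[OF K hom curv] unfolding G by (auto simp: mk_wgraph_def)
  qed (use tK in simp)
qed

end

theorem theorem2p2:
  fixes \<kappa> :: "'v curvature" and G0 :: "'v wgraph" and A :: real and t :: "nat \<Rightarrow> real"
  assumes "finite_wgraph G0"
    and "A > 1"
    and "edges G0 \<noteq> {} \<Longrightarrow> A > Max (weight_ratio (verts G0) (edges G0) (weight G0) ` edges G0)"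
    and "t 0 = 0"
    and "strict_mono t"
    and "filterlim t at_top sequentially"
  shows "(\<exists>!F. surgery_flow \<kappa> A t G0 F) \<and>
    (\<forall>F. surgery_flow \<kappa> A t G0 F \<longrightarrow>
      (\<exists>T>0.
        (\<forall>k. t (Suc k) \<ge> T \<longrightarrow> flow_surgery_edges A t G0 F k = {}) \<and>
        (component_local \<kappa> \<longrightarrow>
          (\<forall>\<gamma>. homogeneous \<gamma> \<kappa> \<longrightarrow>
            (\<forall>s\<ge>T. \<forall>(V', E')\<in>components (verts (evolving_graph t G0 F s)) (edges (evolving_graph t G0 F s)).
              \<exists>\<Theta>. \<forall>e\<in>E'. \<kappa> (evolving_graph t G0 F s) e = \<Theta>)))))"
proof -
  interpret flow_data \<kappa> A t G0
    using assms by unfold_locales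
  \<comment> \<open>Each flow instantiates the solution locale, which yields both its equality with
    \<open>canonical_flow\<close> and its own \<open>T\<close>.\<close>
  have sol: "surgery_flow_solution \<kappa> A t G0 F" if "surgery_flow \<kappa> A t G0 F" for F
    using that by unfold_locales
  show ?thesis
    using surgery_flow_canonical surgery_flow_solution.flow_eq_canonical[OF sol]
      surgery_flow_solution.eventually_constant_curvature[OF sol]
    by blast
qed

end
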